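(* Let $\rho=\mathbf 1_{[0,1]}$ be the uniform density on $[0,1]$, and for $k\in\mathbb N=\{1,2,\dots\}$ let $\sigma_k=2\cdot\mathbf 1_{H_k}$, where $H_k=\bigcup_{j=0}^{2^{k-1}-1}\left[\frac{j}{2^{k-1}},\frac{j}{2^{k-1}}+\frac1{2^k}\right]$. Let $q$ be the probability distribution assigning to $\sigma_k$ the weight $q_k=\frac{6}{\pi^2}\frac1{k^2}$, $k\in\mathbb N$. Then for every $k\in\mathbb N$: 1. $\mathrm s(\rho\|q)=\log2<\infty=\mathrm s(\rho\|\sigma_k)$; 2. $\mathrm d_r(\rho\|q)=\max\{\log2-r,0\}<\log2=\mathrm d_r(\rho\|\sigma_k)$ for all $r>0$; 3. $\mathrm c(\rho\|q)=\frac12\log2<\log2=\mathrm c(\rho\|\sigma_k)$.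
   Context: For a probability density $\omega$ on $[0,1]$ (w.r.t. Lebesgue measure $\lambda$), $\omega^{\otimes n}$ is the product density on $[0,1]^n$. A test on $n$ samples is a measurable function $T_n:[0,1]^n\to[0,1]$, and $\omega^{\otimes n}(T_n)=\int_{[0,1]^n}\omega^{\otimes n}T_n\,d\lambda$. The type I error is $\alpha_n(T_n)=\rho^{\otimes n}(1-T_n)$. The type II error is $\beta_n(T_n)=\sigma_k^{\otimes n}(T_n)$ for the exponents $\mathrm e(\rho\|\sigma_k)$, and $\beta_n(T_n)=\sum_{k=1}^\infty q_k\,\sigma_k^{\otimes n}(T_n)$ for the exponents $\mathrm e(\rho\|q)$. In each case ($\log$ natural, $-\log0=+\infty$): the Stein exponent $\mathrm s$ is the supremum of $\liminf_n-\frac1n\log\beta_n(T_n)$ over test sequences with $\lim_n\alpha_n(T_n)=0$; the direct exponent $\mathrm d_r$ ($r>0$) is the supremum of $\liminf_n-\frac1n\log\alpha_n(T_n)$ over test sequences with $\liminf_n-\frac1n\log\beta_n(T_n)\ge r$; the Chernoff exponent $\mathrm c$ is the supremum of all $r\ge0$ for which some test sequence satisfies both $\liminf_n-\frac1n\log\alpha_n(T_n)\ge r$ and $\liminf_n-\frac1n\log\beta_n(T_n)\ge r$. *)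

theory Defs
  imports "HOL-Analysis.Analysis"
begin

text \<open>The cube \<open>[0,1]^n\<close> with Lebesgue measure; points are functions on \<open>{..<n}\<close>.\<close>
definition cube :: "nat \<Rightarrow> (nat \<Rightarrow> real) measure" where
  "cube n = (\<Pi>\<^sub>M i\<in>{..<n}. restrict_space lborel {0..1})"

definition is_test :: "nat \<Rightarrow> ((nat \<Rightarrow> real) \<Rightarrow> real) \<Rightarrow> bool" where
  "is_test n T \<longleftrightarrow> T \<in> borel_measurable (cube n) \<and> (\<forall>x\<in>space (cube n). 0 \<le> T x \<and> T x \<le> 1)"

definition is_test_seq :: "(nat \<Rightarrow> (nat \<Rightarrow> real) \<Rightarrow> real) \<Rightarrow> bool" where
  "is_test_seq T \<longleftrightarrow> (\<forall>n\<ge>1. is_test n (T n))"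

definition prod_density :: "(real \<Rightarrow> real) \<Rightarrow> nat \<Rightarrow> (nat \<Rightarrow> real) \<Rightarrow> real" where
  "prod_density \<omega> n x = (\<Prod>i<n. \<omega> (x i))"

definition prod_expect :: "(real \<Rightarrow> real) \<Rightarrow> nat \<Rightarrow> ((nat \<Rightarrow> real) \<Rightarrow> real) \<Rightarrow> real" where
  "prod_expect \<omega> n T = (LINT x|cube n. prod_density \<omega> n x * T x)"

definition type1_error :: "(real \<Rightarrow> real) \<Rightarrow> nat \<Rightarrow> ((nat \<Rightarrow> real) \<Rightarrow> real) \<Rightarrow> real" where
  "type1_error \<rho> n T = prod_expect \<rho> n (\<lambda>x. 1 - T x)"

definition type2_error :: "(real \<Rightarrow> real) \<Rightarrow> nat \<Rightarrow> ((nat \<Rightarrow> real) \<Rightarrow> real) \<Rightarrow> real" where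
  "type2_error \<sigma> n T = prod_expect \<sigma> n T"

text \<open>The weights and the alternatives are indexed by \<open>k \<ge> 1\<close>, hence the \<open>Suc\<close>.\<close>
definition type2_error_mix ::
  "(nat \<Rightarrow> real) \<Rightarrow> (nat \<Rightarrow> real \<Rightarrow> real) \<Rightarrow> nat \<Rightarrow> ((nat \<Rightarrow> real) \<Rightarrow> real) \<Rightarrow> real" where
  "type2_error_mix q \<sigma> n T = (\<Sum>k. q (Suc k) * prod_expect (\<sigma> (Suc k)) n T)"

text \<open>Only applied to error probabilities, which are nonnegative; \<open>ln 0 = 0\<close> on the reals,
  so \<open>- log 0 = \<infinity>\<close> has to be set explicitly.\<close>
definition neg_log :: "real \<Rightarrow> ereal" where
  "neg_log a = (if a = 0 then \<infinity> else ereal (- ln a))"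

definition error_rate :: "(nat \<Rightarrow> real) \<Rightarrow> ereal" where
  "error_rate a = liminf (\<lambda>n. ereal (1 / real n) * neg_log (a n))"

text \<open>In the following, \<open>\<beta> n T\<close> is the type II error of the test \<open>T\<close> on \<open>n\<close> samples; it is
  \<open>type2_error \<sigma>\<close> for a simple alternative and \<open>type2_error_mix q \<sigma>\<close> for a mixed one.\<close>
definition stein_exp ::
  "(real \<Rightarrow> real) \<Rightarrow> (nat \<Rightarrow> ((nat \<Rightarrow> real) \<Rightarrow> real) \<Rightarrow> real) \<Rightarrow> ereal" where
  "stein_exp \<rho> \<beta> = Sup {error_rate (\<lambda>n. \<beta> n (T n)) | T.
     is_test_seq T \<and> (\<lambda>n. type1_error \<rho> n (T n)) \<longlonglongrightarrow> 0}"

definition direct_exp ::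
  "real \<Rightarrow> (real \<Rightarrow> real) \<Rightarrow> (nat \<Rightarrow> ((nat \<Rightarrow> real) \<Rightarrow> real) \<Rightarrow> real) \<Rightarrow> ereal" where
  "direct_exp r \<rho> \<beta> = Sup {error_rate (\<lambda>n. type1_error \<rho> n (T n)) | T.
     is_test_seq T \<and> error_rate (\<lambda>n. \<beta> n (T n)) \<ge> ereal r}"

definition chernoff_exp ::
  "(real \<Rightarrow> real) \<Rightarrow> (nat \<Rightarrow> ((nat \<Rightarrow> real) \<Rightarrow> real) \<Rightarrow> real) \<Rightarrow> ereal" where
  "chernoff_exp \<rho> \<beta> = Sup {ereal r | r. 0 \<le> r \<and> (\<exists>T. is_test_seq T \<and>
     error_rate (\<lambda>n. type1_error \<rho> n (T n)) \<ge> ereal r \<and>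
     error_rate (\<lambda>n. \<beta> n (T n)) \<ge> ereal r)}"

definition rho_dens :: "real \<Rightarrow> real" where
  "rho_dens = indicator {0..1}"

definition H_set :: "nat \<Rightarrow> real set" where
  "H_set k = (\<Union>j<2 ^ (k - 1). {real j / 2 ^ (k - 1) .. real j / 2 ^ (k - 1) + 1 / 2 ^ k})"

definition sigma_dens :: "nat \<Rightarrow> real \<Rightarrow> real" where
  "sigma_dens k x = 2 * indicator (H_set k) x"

definition q_weight :: "nat \<Rightarrow> real" where
  "q_weight k = 6 / pi\<^sup>2 * (1 / (real k)\<^sup>2)"

end

theory Submission
  imports Defs "HOL-Probability.Probability"
begin

text \<open>
  Up to null sets, \<open>H_k\<close> is the event that the \<open>k\<close>-th binary digit vanishes, so under the uniform
  distribution the cubes \<open>H_k^n\<close> are pairwise independent events of probability \<open>2^-n\<close>.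

  Rejecting \<open>\<rho>\<close> on \<open>H_1^n \<union> \<dots> \<union> H_K^n\<close> gives \<open>\<alpha> \<le> K / 2^n\<close> and \<open>\<beta> \<le> \<Sum>k>K. q_k = O(1 / K)\<close>;
  with \<open>K\<close> of order \<open>e^(na)\<close> the rates are \<open>ln 2 - a\<close> and \<open>a\<close>.

  Conversely, let \<open>Y\<close> be the sum of the densities of \<open>\<sigma>_1^n, \<dots>, \<sigma>_K^n\<close>. By pairwise independence it
  has mean \<open>K\<close> and second moment at most \<open>K (2^n + K)\<close>. If \<open>\<beta> < 1 / (8 K)\<close> then
  \<open>E[Y T] \<le> K / 2\<close>, as \<open>q_k\<close> is at least of order \<open>1 / K^2\<close> for \<open>k \<le> K\<close>; hence
  \<open>E[Y (1 - T)] \<ge> K / 2\<close>, and Cauchy-Schwarz yields \<open>\<alpha> \<ge> K / (4 (2^n + K))\<close>. The choice \<open>K = 2^n\<close>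
  bounds the Stein exponent, and \<open>K\<close> of order \<open>1 / \<beta>\<close> bounds the other two.
\<close>

subsection \<open>Lebesgue measure of the sets \<open>H_k\<close>\<close>

lemma H_set_Suc_iff:
  "x \<in> H_set (Suc m) \<longleftrightarrow> (\<exists>j<2 ^ m. real j \<le> 2 ^ m * x \<and> 2 ^ m * x \<le> real j + 1 / 2)"
  by (auto simp: H_set_def field_simps)

text \<open>For \<open>S\<close> inside \<open>[0,1)\<close> this is the preimage of
  \<open>S\<close> in \<open>[0,1)\<close> under the doubling map \<open>x mapsto 2 x mod 1\<close>,
  which drops the first binary digit. The form as two affine copies lets measures be computed copy
  by copy.\<close>

definition halves :: "real set \<Rightarrow> real set" where
  "halves S = (\<lambda>x. x / 2) ` S \<union> (\<lambda>x. x / 2 + 1 / 2) ` S"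

lemma halves_iff: "x \<in> halves S \<longleftrightarrow> 2 * x \<in> S \<or> 2 * x - 1 \<in> S"
proof -
  have "x \<in> (\<lambda>x. x / 2) ` S \<longleftrightarrow> 2 * x \<in> S"
    by (auto intro: image_eqI[of _ _ "2 * x"])
  moreover have "x \<in> (\<lambda>x. x / 2 + 1 / 2) ` S \<longleftrightarrow> 2 * x - 1 \<in> S"
    by (auto intro!: image_eqI[of _ _ "2 * x - 1"] simp: field_simps)
  ultimately show ?thesis by (simp add: halves_def)
qed

text \<open>Dropping the first binary digit turns a condition on digit \<open>m + 2\<close> into the
  same condition on digit \<open>m + 1\<close>. The intervals with \<open>j < 2 ^ m\<close> form the
  left copy, those with \<open>j = 2 ^ m + i\<close> the right one.\<close>

lemma H_set_Suc_Suc: "H_set (Suc (Suc m)) = halves (H_set (Suc m))"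
proof (intro set_eqI)
  fix x :: real
  let ?P = "\<lambda>j. real j \<le> 2 ^ m * (2 * x) \<and> 2 ^ m * (2 * x) \<le> real j + 1 / 2"
  have "x \<in> H_set (Suc (Suc m)) \<longleftrightarrow> (\<exists>j<2 ^ m + 2 ^ m. ?P j)"
    by (simp add: H_set_Suc_iff mult_ac mult_2[of "2 ^ m :: nat"])
  also have "\<dots> \<longleftrightarrow> (\<exists>j<2 ^ m. ?P j) \<or> (\<exists>j<2 ^ m. ?P (2 ^ m + j))"
  proof
    assume "\<exists>j<2 ^ m + 2 ^ m. ?P j"
    then obtain j where j: "j < 2 ^ m + 2 ^ m" "?P j" by blast
    show "(\<exists>j<2 ^ m. ?P j) \<or> (\<exists>j<2 ^ m. ?P (2 ^ m + j))"
    proof (cases "j < 2 ^ m")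
      case False
      then obtain i where "j = 2 ^ m + i" by (metis le_Suc_ex not_less)
      with j have "i < 2 ^ m" "?P (2 ^ m + i)" by auto
      then show ?thesis by blast
    qed (use j in blast)
  next
    assume "(\<exists>j<2 ^ m. ?P j) \<or> (\<exists>j<2 ^ m. ?P (2 ^ m + j))"
    then show "\<exists>j<2 ^ m + 2 ^ m. ?P j"
      by (meson add_strict_left_mono trans_less_add1)
  qed
  also have "\<dots> \<longleftrightarrow> x \<in> halves (H_set (Suc m))"
    by (simp add: halves_iff H_set_Suc_iff right_diff_distrib algebra_simps)
  finally show "x \<in> H_set (Suc (Suc m)) \<longleftrightarrow> x \<in> halves (H_set (Suc m))" .
qed

lemma H_set_one: "H_set (Suc 0) = {0..1 / 2}"
  by (auto simp: H_set_def)

lemma H_set_measurable [measurable]: "H_set k \<in> sets borel"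
  unfolding H_set_def by measurable

lemma halves_subset: "S \<subseteq> {0..<1} \<Longrightarrow> halves S \<subseteq> {0..<1}"
  by (force simp: halves_def)

text \<open>Leaving out the point 1 matters: the two copies in \<open>halves\<close> then lie in
  \<open>[0,1/2)\<close> and \<open>[1/2,1)\<close> and are disjoint.\<close>

lemma H_set_subset: "H_set (Suc m) \<subseteq> {0..<1}"
  by (induction m) (auto simp: H_set_one H_set_Suc_Suc dest!: halves_subset)

text \<open>The left copy of one set cannot meet the right copy of the other: the former forces
  \<open>2 * x < 1\<close>, the latter \<open>2 * x \<ge> 1\<close>.\<close>

lemma halves_Int:
  assumes "S \<subseteq> {0..<1}" "S' \<subseteq> {0..<1}"
  shows "halves S \<inter> halves S' = halves (S \<inter> S')"
  using assms by (auto simp: halves_iff; force)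

lemma
  fixes S :: "real set"
  assumes "S \<in> sets borel" and sub: "S \<subseteq> {0..<1}"
  shows half_fmeasurable: "(\<lambda>x. x / 2 + c) ` S \<in> lmeasurable"
    and measure_half: "measure lebesgue ((\<lambda>x. x / 2 + c) ` S) = measure lborel S / 2"
proof -
  have "(\<lambda>x. x / 2 + c) ` S = (\<lambda>y. 2 * y - 2 * c) -` S"
    by (auto intro!: image_eqI[of _ _ "2 * y - 2 * c" for y] simp: field_simps)
  also have "\<dots> \<in> sets borel"
    using measurable_sets[of "\<lambda>y::real. 2 * y - 2 * c" borel borel S] assms(1) by simp
  finally have borel: "(\<lambda>x. x / 2 + c) ` S \<in> sets borel" .
  have "(\<lambda>x. x / 2 + c) ` S \<subseteq> {c..c + 1}" using sub by force
  then have "bounded ((\<lambda>x. x / 2 + c) ` S)" by (rule bounded_subset[rotated]) simp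
  with borel show "(\<lambda>x. x / 2 + c) ` S \<in> lmeasurable"
    by (auto intro: bounded_set_imp_lmeasurable)
  show "measure lebesgue ((\<lambda>x. x / 2 + c) ` S) = measure lborel S / 2"
    using measure_lebesgue_affine[of "1/2" c S] assms(1) by (simp add: add.commute)
qed

text \<open>The doubling map preserves Lebesgue measure: the two copies are disjoint and each has
  half the measure of \<open>S\<close>.\<close>

lemma measure_halves:
  assumes "S \<in> sets borel" "S \<subseteq> {0..<1}" "halves S \<in> sets borel"
  shows "measure lborel (halves S) = measure lborel S"
proof -
  have "measure lborel (halves S) = measure lebesgue (halves S)"
    using assms(3) by simp
  also have "\<dots> = measure lebesgue ((\<lambda>x. x / 2 + 0) ` S) + measure lebesgue ((\<lambda>x. x / 2 + 1 / 2) ` S)"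
  proof -
    have "(\<lambda>x. x / 2 + 0) ` S \<inter> (\<lambda>x. x / 2 + 1 / 2) ` S = {}"
      using assms(2) by (auto simp: subset_eq) (smt (verit) field_sum_of_halves)
    then show ?thesis
      using measure_Un3[OF half_fmeasurable[OF assms(1,2), of 0] half_fmeasurable[OF assms(1,2), of "1/2"]]
      by (simp add: halves_def)
  qed
  also have "\<dots> = measure lborel S"
    using measure_half[OF assms(1,2), of 0] measure_half[OF assms(1,2), of "1 / 2"] by simp
  finally show ?thesis .
qed

lemma measure_H_set: "measure lborel (H_set (Suc m)) = 1 / 2"
proof (induction m)
  case (Suc m)
  then show ?case
    using measure_halves[OF _ H_set_subset] H_set_Suc_Suc[of m] by (metis H_set_measurable)
qed (simp add: H_set_one)

text \<open>Common leading digits are peeled off with \<open>halves\<close>, which preserves the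
  measure, until the smaller index belongs to the left half interval. That interval cuts the left
  copy out of the other set, leaving half of its measure 1/2.\<close>

lemma measure_H_set_Int_less: "i < j \<Longrightarrow> measure lborel (H_set (Suc i) \<inter> H_set (Suc j)) = 1 / 4"
proof (induction i arbitrary: j)
  case 0
  then obtain m where m: "j = Suc m" by (cases j) auto
  let ?S = "H_set (Suc m)"
  have sub: "?S \<subseteq> {0..<1}" by (rule H_set_subset)
  have lm: "(\<lambda>x. x / 2) ` ?S \<in> lmeasurable"
    using half_fmeasurable[OF H_set_measurable H_set_subset, of 0] by simp
  have "measure lborel (H_set (Suc 0) \<inter> H_set (Suc j)) = measure lebesgue (H_set (Suc 0) \<inter> H_set (Suc j))"
    by simp
  also have "\<dots> = measure lebesgue ((\<lambda>x. x / 2) ` ?S)"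
  proof (rule measure_negligible_symdiff)
    \<comment> \<open>The closed interval \<open>H_set (Suc 0)\<close> may pick up the point 1/2
      from the right copy; this is the only discrepancy.\<close>
    have "(\<lambda>x. x / 2) ` ?S - H_set (Suc 0) \<inter> H_set (Suc j) \<union>
        (H_set (Suc 0) \<inter> H_set (Suc j) - (\<lambda>x. x / 2) ` ?S) \<subseteq> {1 / 2}"
      using sub by (auto simp: m H_set_Suc_Suc H_set_one halves_def)
    then show "negligible ((\<lambda>x. x / 2) ` ?S - H_set (Suc 0) \<inter> H_set (Suc j) \<union>
        (H_set (Suc 0) \<inter> H_set (Suc j) - (\<lambda>x. x / 2) ` ?S))"
      by (rule negligible_subset[rotated]) simp
  qed (use lm in auto)
  also have "\<dots> = 1 / 4"
    using measure_half[OF H_set_measurable H_set_subset, of 0] by (simp add: measure_H_set)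
  finally show ?case .
next
  case (Suc i)
  then obtain m where m: "j = Suc m" by (cases j) auto
  have eq: "H_set (Suc (Suc i)) \<inter> H_set (Suc j) = halves (H_set (Suc i) \<inter> H_set (Suc m))"
    by (simp add: m H_set_Suc_Suc halves_Int H_set_subset)
  have "measure lborel (halves (H_set (Suc i) \<inter> H_set (Suc m))) = measure lborel (H_set (Suc i) \<inter> H_set (Suc m))"
    using H_set_subset[of i] by (intro measure_halves) (auto simp flip: eq)
  with Suc m eq show ?case by simp
qed

lemma measure_H_set_Int:
  assumes "i \<noteq> j"
  shows "measure lborel (H_set (Suc i) \<inter> H_set (Suc j)) = 1 / 4"
  using assms measure_H_set_Int_less[of i j] measure_H_set_Int_less[of j i]
  by (auto simp: neq_iff Int_commute)

subsection \<open>Tests on the cube\<close>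

abbreviation unit_lborel :: "real measure" where
  "unit_lborel \<equiv> restrict_space lborel {0..1}"

lemma prob_space_unit_lborel: "prob_space unit_lborel"
  by (rule prob_spaceI) (simp add: emeasure_restrict_space)

lemma finite_product_prob_space_cube:
  "finite_product_prob_space (\<lambda>_. unit_lborel) {..<n :: nat}"
proof -
  interpret prob_space unit_lborel by (rule prob_space_unit_lborel)
  show ?thesis by unfold_locales simp
qed

lemma prob_space_cube: "prob_space (cube n)"
proof -
  interpret C: finite_product_prob_space "\<lambda>_. unit_lborel" "{..<n}"
    by (rule finite_product_prob_space_cube)
  show ?thesis unfolding cube_def by (rule C.prob_space_axioms)
qed

lemma space_cube: "space (cube n) = {..<n} \<rightarrow>\<^sub>E {0..1}"
  by (simp add: cube_def space_PiM)

lemma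
  assumes "S \<in> sets borel" "S \<subseteq> {0..1}"
  shows sets_cube_PiE: "{..<n} \<rightarrow>\<^sub>E S \<in> sets (cube n)"
    and measure_cube_PiE: "measure (cube n) ({..<n} \<rightarrow>\<^sub>E S) = measure lborel S ^ n"
proof -
  interpret C: finite_product_prob_space "\<lambda>_. unit_lborel" "{..<n}"
    by (rule finite_product_prob_space_cube)
  have S: "S \<in> sets unit_lborel"
    using assms by (auto simp: sets_restrict_space_iff)
  then show "{..<n} \<rightarrow>\<^sub>E S \<in> sets (cube n)"
    unfolding cube_def by (intro sets_PiM_I_finite) auto
  show "measure (cube n) ({..<n} \<rightarrow>\<^sub>E S) = measure lborel S ^ n"
    unfolding cube_def using assms S by (subst C.prob_times) (auto simp: measure_restrict_space)
qed

text \<open>The index is shifted: \<open>H_cube k\<close> belongs to the alternative \<open>\<sigma>\<^bsub>k+1\<^esub>\<close>.\<close>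
definition H_cube :: "nat \<Rightarrow> nat \<Rightarrow> (nat \<Rightarrow> real) set" where
  "H_cube k n = {..<n} \<rightarrow>\<^sub>E H_set (Suc k)"

lemma H_set_subset_unit: "H_set (Suc k) \<subseteq> {0..1}"
  using H_set_subset[of k] by force

lemma sets_H_cube [measurable]: "H_cube k n \<in> sets (cube n)"
  unfolding H_cube_def by (intro sets_cube_PiE H_set_measurable H_set_subset_unit)

lemma measure_H_cube: "measure (cube n) (H_cube k n) = 1 / 2 ^ n"
  unfolding H_cube_def
  by (simp add: measure_cube_PiE H_set_subset_unit measure_H_set power_divide)

text \<open>This is pairwise independence: the value is the square of \<open>1 / 2 ^ n\<close>,
  obtained from the one-dimensional 1/4 in each coordinate.\<close>

lemma measure_H_cube_Int:
  assumes "j \<noteq> k"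
  shows "measure (cube n) (H_cube j n \<inter> H_cube k n) = 1 / 4 ^ n"
proof -
  have "H_set (Suc j) \<inter> H_set (Suc k) \<subseteq> {0..1}"
    using H_set_subset_unit[of j] by blast
  moreover have "H_cube j n \<inter> H_cube k n = {..<n} \<rightarrow>\<^sub>E (H_set (Suc j) \<inter> H_set (Suc k))"
    by (simp add: H_cube_def PiE_Int)
  ultimately show ?thesis
    using assms by (simp add: measure_cube_PiE measure_H_set_Int power_divide)
qed

section \<open>Densities and error probabilities on the cube\<close>

lemma prod_density_rho: "x \<in> space (cube n) \<Longrightarrow> prod_density rho_dens n x = 1"
  by (auto simp: prod_density_def rho_dens_def space_cube PiE_iff intro!: prod.neutral)

lemma prod_density_sigma:
  assumes "x \<in> space (cube n)"
  shows "prod_density (sigma_dens (Suc k)) n x = 2 ^ n * indicator (H_cube k n) x"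
proof (cases "x \<in> H_cube k n")
  case True
  then show ?thesis
    by (auto simp: prod_density_def sigma_dens_def H_cube_def PiE_iff)
next
  case False
  with assms obtain i where "i < n" "x i \<notin> H_set (Suc k)"
    by (auto simp: H_cube_def space_cube PiE_iff)
  then have "prod_density (sigma_dens (Suc k)) n x = 0"
    unfolding prod_density_def by (intro prod_zero) (auto simp: sigma_dens_def intro!: bexI[of _ i])
  with False show ?thesis by simp
qed

lemma type1_error_rho: "type1_error rho_dens n T = (LINT x|cube n. 1 - T x)"
  unfolding type1_error_def prod_expect_def
  by (intro Bochner_Integration.integral_cong) (auto simp: prod_density_rho)

lemma prod_expect_sigma:
  "prod_expect (sigma_dens (Suc k)) n T = (LINT x|cube n. 2 ^ n * indicator (H_cube k n) x * T x)"
  unfolding prod_expect_def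
  by (intro Bochner_Integration.integral_cong) (auto simp: prod_density_sigma)

lemma integrable_cube:
  fixes f :: "(nat \<Rightarrow> real) \<Rightarrow> real"
  assumes "f \<in> borel_measurable (cube n)" "\<And>x. x \<in> space (cube n) \<Longrightarrow> \<bar>f x\<bar> \<le> C"
  shows "integrable (cube n) f"
proof -
  interpret prob_space "cube n" by (rule prob_space_cube)
  show ?thesis using assms by (intro integrable_const_bound[of _ C]) auto
qed

lemma is_testD:
  assumes "is_test n T"
  shows "T \<in> borel_measurable (cube n)" "x \<in> space (cube n) \<Longrightarrow> 0 \<le> T x"
    "x \<in> space (cube n) \<Longrightarrow> T x \<le> 1"
  using assms by (auto simp: is_test_def)

lemma integrable_indicator_test:
  assumes "is_test n T"
  shows "integrable (cube n) (\<lambda>x. c * indicator (H_cube k n) x * T x)"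
proof (rule integrable_cube[where C="\<bar>c\<bar>"])
  have [measurable]: "T \<in> borel_measurable (cube n)" using assms by (rule is_testD)
  show "(\<lambda>x. c * indicator (H_cube k n) x * T x) \<in> borel_measurable (cube n)" by measurable
qed (use is_testD[OF assms] in \<open>auto simp: indicator_def abs_mult mult_left_le\<close>)

lemma integrable_test:
  assumes "is_test n T"
  shows "integrable (cube n) T"
  using is_testD[OF assms] by (intro integrable_cube[where C=1]) auto

lemma is_test_compl: "is_test n T \<Longrightarrow> is_test n (\<lambda>x. 1 - T x)"
  by (auto simp: is_test_def)

lemma is_test_one: "is_test n (\<lambda>_. 1)"
  by (simp add: is_test_def)

lemma type1_error_bounds:
  assumes "is_test n T"
  shows "0 \<le> type1_error rho_dens n T" "type1_error rho_dens n T \<le> 1"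
proof -
  interpret prob_space "cube n" by (rule prob_space_cube)
  note T = is_testD[OF is_test_compl[OF assms]]
  show "0 \<le> type1_error rho_dens n T"
    unfolding type1_error_rho using T(2) by (intro integral_nonneg_AE) auto
  have "type1_error rho_dens n T \<le> (LINT x|cube n. 1)"
    unfolding type1_error_rho
    using T(3) by (intro integral_mono integrable_test is_test_one is_test_compl[OF assms]) auto
  then show "type1_error rho_dens n T \<le> 1" by (simp add: prob_space)
qed

lemma sigma_error_bounds:
  assumes "is_test n T"
  shows "0 \<le> prod_expect (sigma_dens (Suc k)) n T" "prod_expect (sigma_dens (Suc k)) n T \<le> 1"
proof -
  note T = is_testD[OF assms]
  show "0 \<le> prod_expect (sigma_dens (Suc k)) n T"
    unfolding prod_expect_sigma using T(2) by (intro integral_nonneg_AE) auto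
  have "prod_expect (sigma_dens (Suc k)) n T \<le> (LINT x|cube n. 2 ^ n * indicator (H_cube k n) x * 1)"
    unfolding prod_expect_sigma
    using T(3) by (intro integral_mono integrable_indicator_test is_test_one assms)
      (auto simp: mult_left_le)
  then show "prod_expect (sigma_dens (Suc k)) n T \<le> 1" by (simp add: measure_H_cube)
qed

text \<open>The likelihood ratio of each alternative to the uniform distribution is at most
  \<open>2 ^ n\<close>; integrating this against \<open>1 - T\<close> gives the bound. It is what
  caps the type I rate at \<open>ln 2\<close> for simple alternatives.\<close>

lemma sigma_error_ge:
  assumes "is_test n T"
  shows "1 - prod_expect (sigma_dens (Suc k)) n T \<le> 2 ^ n * type1_error rho_dens n T"
proof -
  interpret prob_space "cube n" by (rule prob_space_cube)
  note T = is_testD[OF is_test_compl[OF assms]]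
  have "1 - prod_expect (sigma_dens (Suc k)) n T
      = (LINT x|cube n. 2 ^ n * indicator (H_cube k n) x * 1) - (LINT x|cube n. 2 ^ n * indicator (H_cube k n) x * T x)"
    unfolding prod_expect_sigma by (simp add: measure_H_cube)
  also have "\<dots> = (LINT x|cube n. 2 ^ n * indicator (H_cube k n) x * (1 - T x))"
    by (subst Bochner_Integration.integral_diff[symmetric])
      (auto simp only: right_diff_distrib intro!: integrable_indicator_test is_test_one assms)
  also have "\<dots> \<le> (LINT x|cube n. 2 ^ n * (1 - T x))"
    using T by (intro integral_mono integrable_indicator_test is_test_compl assms
        integrable_mult_right integrable_test) (auto simp: indicator_def)
  finally show ?thesis by (simp add: type1_error_rho)
qed

subsection \<open>Error trade-off for the mixture\<close>

lemma density_sum_second_moment: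
  fixes K n :: nat
  defines "Y \<equiv> \<lambda>x. \<Sum>k<K. 2 ^ n * indicator (H_cube k n) x :: real"
  shows "(LINT x|cube n. (Y x)\<^sup>2) \<le> real K * (2 ^ n + real K)"
proof -
  interpret prob_space "cube n" by (rule prob_space_cube)
  have "(LINT x|cube n. (Y x)\<^sup>2)
      = (LINT x|cube n. (\<Sum>j<K. \<Sum>k<K. 4 ^ n * indicator (H_cube j n \<inter> H_cube k n) x))"
  proof (intro Bochner_Integration.integral_cong refl)
    fix x
    have "(4 :: real) ^ n = 2 ^ n * 2 ^ n" by (simp flip: power_mult_distrib)
    then show "(Y x)\<^sup>2 = (\<Sum>j<K. \<Sum>k<K. 4 ^ n * indicator (H_cube j n \<inter> H_cube k n) x)"
      by (simp only: Y_def power2_eq_square sum_product indicator_inter_arith mult_ac)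
  qed
  also have "\<dots> = (\<Sum>j<K. \<Sum>k<K. 4 ^ n * measure (cube n) (H_cube j n \<inter> H_cube k n))"
  proof -
    have "integrable (cube n) (\<lambda>x. 4 ^ n * indicator (H_cube j n \<inter> H_cube k n) x :: real)" for j k
      by (intro integrable_mult_right integrable_real_indicator) (auto simp: emeasure_eq_measure)
    moreover have "H_cube j n \<inter> H_cube k n \<inter> space (cube n) = H_cube j n \<inter> H_cube k n" for j k
      using sets.sets_into_space[OF sets_H_cube] by blast
    ultimately show ?thesis
      by (simp only: Bochner_Integration.integral_sum Bochner_Integration.integrable_sum
          integral_mult_right_zero Bochner_Integration.integral_indicator)
  qed
  \<comment> \<open>Diagonal terms equal \<open>4 ^ n / 2 ^ n = 2 ^ n\<close>, off-diagonal ones 1.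
    Adding 1 on the diagonal as well makes the double sum split.\<close>
  also have "\<dots> \<le> (\<Sum>j<K. \<Sum>k<K. (if j = k then 2 ^ n else 0) + 1)"
  proof (intro sum_mono)
    fix j k
    have "(4 :: real) ^ n = 2 ^ n * 2 ^ n" by (simp flip: power_mult_distrib)
    then show "4 ^ n * measure (cube n) (H_cube j n \<inter> H_cube k n) \<le> (if j = k then 2 ^ n else 0) + 1"
      by (simp add: measure_H_cube measure_H_cube_Int)
  qed
  also have "\<dots> = real K * (2 ^ n + real K)"
    by (simp add: sum.distrib algebra_simps)
  finally show ?thesis .
qed

section \<open>Bounds on the weights and on the mixed type II error\<close>

lemma q_weight_ge:
  assumes "k < K"
  shows "q_weight (Suc k) \<ge> 1 / (4 * (real K)\<^sup>2)"
proof -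
  have "pi\<^sup>2 \<le> 4\<^sup>2" using pi_less_4 pi_gt_zero by (intro power_mono) auto
  then have "1 / 4 \<le> 6 / pi\<^sup>2" by (simp add: field_simps)
  moreover have "1 / (real K)\<^sup>2 \<le> 1 / (real (Suc k))\<^sup>2"
    using assms by (intro divide_left_mono power_mono) auto
  ultimately have "1 / 4 * (1 / (real K)\<^sup>2) \<le> q_weight (Suc k)"
    unfolding q_weight_def by (intro mult_mono) auto
  then show ?thesis by simp
qed

lemma q_weight_le: "q_weight k \<le> 2 / (real k)\<^sup>2"
proof -
  have "2\<^sup>2 \<le> pi\<^sup>2" using pi_ge_two by (intro power_mono) auto
  then have "6 / pi\<^sup>2 \<le> 2" by (simp add: field_simps)
  then show ?thesis
    unfolding q_weight_def using mult_right_mono[of "6 / pi\<^sup>2" 2 "1 / (real k)\<^sup>2"] by simp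
qed

lemma q_weight_nonneg: "0 \<le> q_weight k"
  by (simp add: q_weight_def)

lemma summable_q_weight: "summable (\<lambda>k. q_weight (Suc k))"
  unfolding q_weight_def
  using sums_summable[OF inverse_squares_sums] by (intro summable_mult) (simp add: add.commute)

text \<open>Each \<open>1 / k^2\<close> is at most \<open>1 / (k - 1) - 1 / k\<close>, so the tail
  is dominated by a telescoping series; \<open>K \<ge> 1\<close> keeps the denominators
  positive.\<close>

lemma q_weight_tail:
  assumes "K \<ge> 1"
  shows "(\<Sum>k. q_weight (Suc (k + K))) \<le> 2 / real K"
proof -
  let ?g = "\<lambda>k. 2 / real (k + K)"
  have "?g \<longlonglongrightarrow> 0" by real_asymp
  then have sums: "(\<lambda>k. ?g k - ?g (Suc k)) sums (?g 0 - 0)"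
    by (rule telescope_sums')
  have "(\<Sum>k. q_weight (Suc (k + K))) \<le> (\<Sum>k. ?g k - ?g (Suc k))"
  proof (rule suminf_le)
    fix k
    have "q_weight (Suc (k + K)) \<le> 2 / (real (Suc (k + K)))\<^sup>2" by (rule q_weight_le)
    also have "\<dots> \<le> 2 / (real (k + K) * real (Suc (k + K)))"
      using assms unfolding power2_eq_square by (intro divide_left_mono mult_right_mono) auto
    also have "\<dots> = ?g k - ?g (Suc k)"
      using assms by (simp add: field_simps)
    finally show "q_weight (Suc (k + K)) \<le> ?g k - ?g (Suc k)" .
  next
    show "summable (\<lambda>k. q_weight (Suc (k + K)))"
      using summable_ignore_initial_segment[OF summable_q_weight, of K] by simp
  qed (use sums in \<open>rule sums_summable\<close>)
  also have "\<dots> = 2 / real K" using sums_unique[OF sums] by simp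
  finally show ?thesis .
qed

lemma summable_mix:
  assumes "is_test n T"
  shows "summable (\<lambda>k. q_weight (Suc k) * prod_expect (sigma_dens (Suc k)) n T)"
  using sigma_error_bounds[OF assms] q_weight_nonneg
  by (intro summable_comparison_test'[OF summable_q_weight]) (auto simp: abs_mult mult_left_le)

lemma type2_error_mix_nonneg:
  assumes "is_test n T"
  shows "0 \<le> type2_error_mix q_weight sigma_dens n T"
  unfolding type2_error_mix_def
  using sigma_error_bounds[OF assms] q_weight_nonneg by (intro suminf_nonneg summable_mix assms) auto

lemma type1_error_mix_tradeoff:
  assumes T: "is_test n T" and K: "K \<ge> 1"
    and small: "type2_error_mix q_weight sigma_dens n T < 1 / (8 * real K)"
  shows "type1_error rho_dens n T \<ge> real K / (4 * (2 ^ n + real K))"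
proof -
  interpret prob_space "cube n" by (rule prob_space_cube)
  note Tb = is_testD[OF T]
  have [measurable]: "T \<in> borel_measurable (cube n)" by fact
  define Y where "Y x = (\<Sum>k<K. 2 ^ n * indicator (H_cube k n) x :: real)" for x
  define m where "m = real K * (2 ^ n + real K)"
  define t where "t = 1 / (2 * (2 ^ n + real K))"
  have [measurable]: "Y \<in> borel_measurable (cube n)" unfolding Y_def by measurable
  have pos: "real K > 0" "(2::real) ^ n + real K > 0" "t > 0" using K by (auto simp: t_def add_pos_pos)
  have Y_bounds: "0 \<le> Y x" "Y x \<le> real K * 2 ^ n" for x
    using sum_bounded_above[of "{..<K}" "\<lambda>k. 2 ^ n * indicator (H_cube k n) x :: real" "2 ^ n"]
    by (auto simp: Y_def indicator_def intro!: sum_nonneg)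
  have int_Y: "integrable (cube n) Y"
    using Y_bounds by (intro integrable_cube[where C="real K * 2 ^ n"]) auto
  have int_Y2: "integrable (cube n) (\<lambda>x. (Y x)\<^sup>2)"
    using Y_bounds by (intro integrable_cube[where C="(real K * 2 ^ n)\<^sup>2"]) (auto intro!: power_mono)
  have int_YT: "integrable (cube n) (\<lambda>x. Y x * T x)"
    unfolding Y_def sum_distrib_right by (intro Bochner_Integration.integrable_sum integrable_indicator_test T)
  have int_U: "integrable (cube n) (\<lambda>x. 1 - T x)"
    by (intro integrable_test is_test_compl T)
  have EY: "(LINT x|cube n. Y x) = real K"
    unfolding Y_def by (subst Bochner_Integration.integral_sum)
      (auto simp: measure_H_cube emeasure_eq_measure intro!: integrable_real_indicator)
  have EYT: "(LINT x|cube n. Y x * T x) = (\<Sum>k<K. prod_expect (sigma_dens (Suc k)) n T)"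
    unfolding Y_def sum_distrib_right prod_expect_sigma
    by (intro Bochner_Integration.integral_sum integrable_indicator_test T)

  \<comment> \<open>The first \<open>K\<close> components alone bound the mixed error from below.
    With \<open>small\<close>, E[Y T] is below \<open>4 K^2 / (8 K) = K / 2\<close>, half of the
    mean of \<open>Y\<close>.\<close>
  have "1 / (4 * (real K)\<^sup>2) * (LINT x|cube n. Y x * T x)
      \<le> (\<Sum>k<K. q_weight (Suc k) * prod_expect (sigma_dens (Suc k)) n T)"
    unfolding EYT sum_distrib_left
    using sigma_error_bounds[OF T] q_weight_ge by (intro sum_mono mult_right_mono) auto
  also have "\<dots> \<le> type2_error_mix q_weight sigma_dens n T"
    unfolding type2_error_mix_def
    using sigma_error_bounds[OF T] q_weight_nonneg by (intro sum_le_suminf summable_mix T) auto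
  also note small
  finally have "(LINT x|cube n. Y x * T x) \<le> real K / 2"
    using pos by (simp add: field_simps power2_eq_square)
  then have half: "real K / 2 \<le> (LINT x|cube n. Y x * (1 - T x))"
    using EY int_Y int_YT by (simp add: right_diff_distrib)

  \<comment> \<open>AM-GM in place of Cauchy-Schwarz; the value of \<open>t\<close> optimises the constants.\<close>
  have amgm: "2 * (Y x * (1 - T x)) \<le> t * (Y x)\<^sup>2 + (1 - T x) / t" if "x \<in> space (cube n)" for x
  proof -
    have "0 \<le> (t * Y x - (1 - T x))\<^sup>2" by simp
    then have "2 * (Y x * (1 - T x)) * t \<le> (t * Y x)\<^sup>2 + (1 - T x)\<^sup>2"
      by (simp add: power2_eq_square algebra_simps)
    \<comment> \<open>Removing the square makes the integral of this term the type I error.\<close>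
    also have "(1 - T x)\<^sup>2 \<le> 1 - T x"
      using Tb(2,3)[OF that] unfolding power2_eq_square by (intro mult_left_le) auto
    finally show ?thesis using pos by (simp add: field_simps power2_eq_square)
  qed
  have "real K \<le> 2 * (LINT x|cube n. Y x * (1 - T x))" using half by simp
  also have "\<dots> = (LINT x|cube n. 2 * (Y x * (1 - T x)))" by simp
  also have "\<dots> \<le> (LINT x|cube n. t * (Y x)\<^sup>2 + (1 - T x) / t)"
    using int_Y int_YT int_Y2 int_U amgm
    by (intro integral_mono) (auto simp: right_diff_distrib)
  also have "\<dots> = t * (LINT x|cube n. (Y x)\<^sup>2) + type1_error rho_dens n T / t"
    using int_Y2 int_U by (simp add: type1_error_rho)
  also have "\<dots> \<le> t * m + type1_error rho_dens n T / t"
    using density_sum_second_moment[of n K] pos unfolding Y_def m_def by simp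
  \<comment> \<open>Here \<open>t = K / (2 m)\<close>, the maximiser of
    \<open>t * (K - t * m)\<close>, which is the lower bound on the type I error for a given
    \<open>t\<close>. Half of \<open>K\<close> is spent on the second moment and half
    remains.\<close>
  also have "t * m = real K / 2" using pos(2) by (simp add: t_def m_def divide_simps)
  finally have "real K / 2 * t \<le> type1_error rho_dens n T"
    using pos by (simp add: field_simps)
  moreover have "real K / 2 * t = real K / (4 * (2 ^ n + real K))"
    by (simp add: t_def)
  ultimately show ?thesis by linarith
qed

text \<open>The value 1 accepts the uniform distribution. A singleton \<open>S\<close> serves a
  simple alternative, \<open>{..<K}\<close> the mixture; indices are shifted as in
  \<open>H_cube\<close>.\<close>

definition union_test :: "nat set \<Rightarrow> nat \<Rightarrow> (nat \<Rightarrow> real) \<Rightarrow> real" where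
  "union_test S n x = 1 - indicator (\<Union>k\<in>S. H_cube k n) x"

lemma is_test_union_test:
  assumes "finite S"
  shows "is_test n (union_test S n)"
proof -
  have "(\<Union>k\<in>S. H_cube k n) \<in> sets (cube n)" using assms by auto
  then show ?thesis unfolding is_test_def union_test_def by (auto simp: indicator_def)
qed

lemma type1_error_union_test:
  assumes "finite S"
  shows "type1_error rho_dens n (union_test S n) \<le> real (card S) / 2 ^ n"
proof -
  interpret prob_space "cube n" by (rule prob_space_cube)
  have "type1_error rho_dens n (union_test S n) = prob (\<Union>k\<in>S. H_cube k n)"
    using assms by (simp add: type1_error_rho union_test_def Int_absorb2 sets.sets_into_space)
  also have "\<dots> \<le> (\<Sum>k\<in>S. prob (H_cube k n))"
    using assms by (intro finite_measure_subadditive_finite) auto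
  finally show ?thesis by (simp add: measure_H_cube)
qed

lemma sigma_error_union_test: "k \<in> S \<Longrightarrow> prod_expect (sigma_dens (Suc k)) n (union_test S n) = 0"
  unfolding prod_expect_sigma union_test_def
  by (subst Bochner_Integration.integral_cong[where g="\<lambda>_. 0"]) (auto simp: indicator_def)

text \<open>The test vanishes on the supports of the first \<open>K\<close> alternatives; the others
  have error at most 1, so only the tail of the weights counts.\<close>

lemma type2_error_mix_union_test:
  assumes "K \<ge> 1"
  shows "type2_error_mix q_weight sigma_dens n (union_test {..<K} n) \<le> 2 / real K"
proof -
  have T: "is_test n (union_test {..<K} n)" by (rule is_test_union_test) simp
  let ?f = "\<lambda>k. q_weight (Suc k) * prod_expect (sigma_dens (Suc k)) n (union_test {..<K} n)"
  have "(\<Sum>k. ?f k) = (\<Sum>k. ?f (k + K))"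
    by (subst suminf_split_initial_segment[OF summable_mix[OF T], of K])
      (simp add: sigma_error_union_test)
  also have "\<dots> \<le> (\<Sum>k. q_weight (Suc (k + K)))"
    using sigma_error_bounds[OF T] q_weight_nonneg
      summable_ignore_initial_segment[OF summable_q_weight, of K]
      summable_ignore_initial_segment[OF summable_mix[OF T], of K]
    by (intro suminf_le) (auto simp: mult_left_le)
  also have "\<dots> \<le> 2 / real K" by (rule q_weight_tail[OF assms])
  finally show ?thesis by (simp add: type2_error_mix_def)
qed

subsection \<open>Exponential rates\<close>

text \<open>A constant factor \<open>C\<close> changes the rate only by \<open>ln C / n\<close>,
  which tends to 0. A vanishing \<open>a n\<close> has infinite rate and is treated apart.\<close>

lemma error_rate_ge:
  assumes "C > 0" "\<And>n. n \<ge> 1 \<Longrightarrow> 0 \<le> a n" "\<forall>\<^sub>F n in sequentially. a n \<le> C * exp (- (c * real n))"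
  shows "ereal c \<le> error_rate a"
proof -
  have "(\<lambda>n. c - ln C / real n) \<longlonglongrightarrow> c" by real_asymp
  then have lim: "(\<lambda>n. ereal (c - ln C / real n)) \<longlonglongrightarrow> ereal c" by simp
  have "liminf (\<lambda>n. ereal (c - ln C / real n)) \<le> error_rate a"
    unfolding error_rate_def
  proof (rule Liminf_mono)
    show "\<forall>\<^sub>F n in sequentially. ereal (c - ln C / real n) \<le> ereal (1 / real n) * neg_log (a n)"
      using assms(3) eventually_ge_at_top[of 1]
    proof eventually_elim
      case (elim n)
      show ?case
      proof (cases "a n = 0")
        case False
        with elim assms(2) have pos: "a n > 0" by (simp add: less_le)
        have "ln (a n) \<le> ln (C * exp (- (c * real n)))"
          using elim pos by simp
        also have "\<dots> = ln C - c * real n" using \<open>C > 0\<close> by (simp add: ln_mult)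
        finally have "(c * real n - ln C) / real n \<le> - ln (a n) / real n"
          by (intro divide_right_mono) auto
        then have "c - ln C / real n \<le> 1 / real n * (- ln (a n))"
          using elim by (simp add: diff_divide_distrib)
        with False show ?thesis by (simp add: neg_log_def)
      qed (use elim in \<open>simp add: neg_log_def\<close>)
    qed
  qed
  with lim_imp_Liminf[OF _ lim] show ?thesis by simp
qed

lemma error_rate_le:
  assumes "C > 0" "\<forall>\<^sub>F n in sequentially. C * exp (- (c * real n)) \<le> a n"
  shows "error_rate a \<le> ereal c"
proof -
  have "(\<lambda>n. c - ln C / real n) \<longlonglongrightarrow> c" by real_asymp
  then have lim: "(\<lambda>n. ereal (c - ln C / real n)) \<longlonglongrightarrow> ereal c" by simp
  have "error_rate a \<le> liminf (\<lambda>n. ereal (c - ln C / real n))"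
    unfolding error_rate_def
  proof (rule Liminf_mono)
    show "\<forall>\<^sub>F n in sequentially. ereal (1 / real n) * neg_log (a n) \<le> ereal (c - ln C / real n)"
      using assms(2) eventually_ge_at_top[of 1]
    proof eventually_elim
      case (elim n)
      have pos: "0 < C * exp (- (c * real n))" using \<open>C > 0\<close> by simp
      have "ln C - c * real n = ln (C * exp (- (c * real n)))"
        using \<open>C > 0\<close> by (simp add: ln_mult)
      also have "\<dots> \<le> ln (a n)" using elim pos by (intro ln_mono) auto
      finally have "1 / real n * (- ln (a n)) \<le> c - ln C / real n"
        using elim by (simp add: field_simps)
      with elim pos show ?case by (auto simp: neg_log_def)
    qed
  qed
  with lim_imp_Liminf[OF _ lim] show ?thesis by simp
qed

text \<open>Passing from a rate back to an exponential bound costs an arbitrarily small part of the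
  exponent: a lower limit is eventually exceeded only by strictly smaller values.\<close>

lemma error_rateD:
  assumes "ereal r \<le> error_rate a" "c < r" "\<And>n. n \<ge> 1 \<Longrightarrow> 0 \<le> a n"
  shows "\<forall>\<^sub>F n in sequentially. a n < exp (- (c * real n))"
proof -
  have "ereal c < error_rate a" using assms(1,2) by (auto intro: less_le_trans[of _ "ereal r"])
  then have "\<forall>\<^sub>F n in sequentially. ereal c < ereal (1 / real n) * neg_log (a n)"
    unfolding error_rate_def by (rule less_LiminfD)
  then show ?thesis
    using eventually_ge_at_top[of 1]
  proof eventually_elim
    case (elim n)
    show ?case
    proof (cases "a n = 0")
      case False
      with elim assms(3) have pos: "a n > 0" by (simp add: less_le)
      from elim False have "c < 1 / real n * (- ln (a n))" by (simp add: neg_log_def)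
      then have "ln (a n) < - (c * real n)" using elim by (simp add: field_simps)
      then show ?thesis using pos by (metis exp_less_cancel_iff exp_ln)
    qed simp
  qed
qed

lemma error_rate_zero: "error_rate (\<lambda>_. 0) = \<infinity>"
proof -
  \<comment> \<open>At \<open>n = 0\<close> the factor \<open>1 / real n\<close> is 0 and so is the
    product; hence only eventually.\<close>
  have "\<forall>\<^sub>F n in sequentially. ereal (1 / real n) * neg_log 0 = \<infinity>"
    using eventually_ge_at_top[of 1] by eventually_elim (simp add: neg_log_def)
  then have "error_rate (\<lambda>_. 0) = liminf (\<lambda>_. \<infinity>)"
    unfolding error_rate_def by (rule Liminf_eq)
  then show ?thesis by (simp add: Liminf_const)
qed

lemma exp_ln2: "exp (ln 2 * real n) = 2 ^ n"
  by (simp add: exp_of_nat2_mult)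

lemma exp_neg_ln2: "exp (- (ln 2 * real n)) = 1 / 2 ^ n"
  by (simp add: exp_minus exp_ln2 inverse_eq_divide)

lemma exp_neg_ln2_diff: "exp (- ((ln 2 - c) * real n)) = exp (c * real n) / 2 ^ n"
proof -
  have "- ((ln 2 - c) * real n) = c * real n - ln 2 * real n" by (simp add: left_diff_distrib)
  then show ?thesis by (simp only: exp_diff exp_ln2)
qed

lemma is_test_seqD: "is_test_seq T \<Longrightarrow> n \<ge> 1 \<Longrightarrow> is_test n (T n)"
  by (simp add: is_test_seq_def)

subsection \<open>Simple alternatives\<close>

text \<open>A positive type II rate pushes the type II error below 1/2 eventually, and then
  \<open>sigma_error_ge\<close> leaves a type I error of at least half of
  \<open>2 ^ -n\<close>.\<close>

lemma type1_rate_simple_le: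
  assumes T: "is_test_seq T"
    and r: "r > 0" "ereal r \<le> error_rate (\<lambda>n. type2_error (sigma_dens (Suc k)) n (T n))"
  shows "error_rate (\<lambda>n. type1_error rho_dens n (T n)) \<le> ereal (ln 2)"
proof (rule error_rate_le[where C="1/2"])
  have "\<forall>\<^sub>F n in sequentially. type2_error (sigma_dens (Suc k)) n (T n) < exp (- (r / 2 * real n))"
    using r sigma_error_bounds(1) is_test_seqD[OF T]
    by (intro error_rateD[OF r(2)]) (auto simp: type2_error_def)
  moreover have "\<forall>\<^sub>F n in sequentially. exp (- (r / 2 * real n)) < 1 / 2"
    using r(1) by real_asymp
  ultimately show "\<forall>\<^sub>F n in sequentially. 1/2 * exp (- (ln 2 * real n)) \<le> type1_error rho_dens n (T n)"
    using eventually_ge_at_top[of 1]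
  proof eventually_elim
    case (elim n)
    have "1 - prod_expect (sigma_dens (Suc k)) n (T n) \<le> 2 ^ n * type1_error rho_dens n (T n)"
      using elim T by (intro sigma_error_ge is_test_seqD)
    with elim have "1 / 2 \<le> 2 ^ n * type1_error rho_dens n (T n)"
      by (simp add: type2_error_def)
    then show ?case unfolding exp_neg_ln2 by (simp add: field_simps)
  qed
qed simp

text \<open>Rejecting exactly on the support of the alternative makes the type II error zero. This
  one test attains all three exponents.\<close>

lemma simple_test:
  obtains T where "is_test_seq T" "error_rate (\<lambda>n. type2_error (sigma_dens (Suc k)) n (T n)) = \<infinity>"
    "\<And>n. 0 \<le> type1_error rho_dens n (T n)" "\<And>n. type1_error rho_dens n (T n) \<le> 1 / 2 ^ n"
    "ereal (ln 2) \<le> error_rate (\<lambda>n. type1_error rho_dens n (T n))"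
proof
  let ?T = "\<lambda>n. union_test {k} n"
  have test: "is_test n (?T n)" for n by (rule is_test_union_test) simp
  then show "is_test_seq ?T" by (simp add: is_test_seq_def)
  show "error_rate (\<lambda>n. type2_error (sigma_dens (Suc k)) n (?T n)) = \<infinity>"
    by (simp add: type2_error_def sigma_error_union_test error_rate_zero)
  show nonneg: "0 \<le> type1_error rho_dens n (?T n)" for n
    by (rule type1_error_bounds test)+
  show le: "type1_error rho_dens n (?T n) \<le> 1 / 2 ^ n" for n
    using type1_error_union_test[of "{k}" n] by simp
  show "ereal (ln 2) \<le> error_rate (\<lambda>n. type1_error rho_dens n (?T n))"
    using nonneg le by (intro error_rate_ge[of 1]) (auto simp: exp_neg_ln2)
qed

section \<open>The three exponents of a simple alternative\<close>

lemma stein_exp_simple: "stein_exp rho_dens (type2_error (sigma_dens (Suc k))) = \<infinity>"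
proof -
  obtain T where T: "is_test_seq T" "error_rate (\<lambda>n. type2_error (sigma_dens (Suc k)) n (T n)) = \<infinity>"
    "\<And>n. 0 \<le> type1_error rho_dens n (T n)" "\<And>n. type1_error rho_dens n (T n) \<le> 1 / 2 ^ n"
    using simple_test[of k] by metis
  have "(\<lambda>n. 1 / 2 ^ n :: real) \<longlonglongrightarrow> 0" by real_asymp
  then have "(\<lambda>n. type1_error rho_dens n (T n)) \<longlonglongrightarrow> 0"
    by (rule tendsto_sandwich[rotated 3]) (use T in auto)
  with T have "\<infinity> \<le> stein_exp rho_dens (type2_error (sigma_dens (Suc k)))"
    unfolding stein_exp_def by (intro Sup_upper CollectI exI[of _ T]) auto
  then show ?thesis by simp
qed

lemma direct_exp_simple:
  assumes "r > 0"
  shows "direct_exp r rho_dens (type2_error (sigma_dens (Suc k))) = ereal (ln 2)"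
proof (rule antisym)
  show "direct_exp r rho_dens (type2_error (sigma_dens (Suc k))) \<le> ereal (ln 2)"
    unfolding direct_exp_def using type1_rate_simple_le[OF _ assms]
    by (intro Sup_least) auto
  obtain T where T: "is_test_seq T" "error_rate (\<lambda>n. type2_error (sigma_dens (Suc k)) n (T n)) = \<infinity>"
    "ereal (ln 2) \<le> error_rate (\<lambda>n. type1_error rho_dens n (T n))"
    using simple_test[of k] by metis
  then have "error_rate (\<lambda>n. type1_error rho_dens n (T n)) \<le> direct_exp r rho_dens (type2_error (sigma_dens (Suc k)))"
    unfolding direct_exp_def by (intro Sup_upper CollectI exI[of _ T]) auto
  with T(3) show "ereal (ln 2) \<le> direct_exp r rho_dens (type2_error (sigma_dens (Suc k)))"
    by (rule order_trans)
qed

lemma chernoff_exp_simple: "chernoff_exp rho_dens (type2_error (sigma_dens (Suc k))) = ereal (ln 2)"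
proof (rule antisym)
  show "chernoff_exp rho_dens (type2_error (sigma_dens (Suc k))) \<le> ereal (ln 2)"
    unfolding chernoff_exp_def
  proof (rule Sup_least, clarify)
    fix r T
    assume *: "0 \<le> r" "is_test_seq T" "ereal r \<le> error_rate (\<lambda>n. type1_error rho_dens n (T n))"
      "ereal r \<le> error_rate (\<lambda>n. type2_error (sigma_dens (Suc k)) n (T n))"
    show "ereal r \<le> ereal (ln 2)"
    proof (cases "r = 0")
      case False
      with * have "error_rate (\<lambda>n. type1_error rho_dens n (T n)) \<le> ereal (ln 2)"
        by (intro type1_rate_simple_le[of T r]) auto
      with * show ?thesis by (metis order_trans)
    qed simp
  qed
  obtain T where T: "is_test_seq T" "error_rate (\<lambda>n. type2_error (sigma_dens (Suc k)) n (T n)) = \<infinity>"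
    "ereal (ln 2) \<le> error_rate (\<lambda>n. type1_error rho_dens n (T n))"
    using simple_test[of k] by metis
  then show "ereal (ln 2) \<le> chernoff_exp rho_dens (type2_error (sigma_dens (Suc k)))"
    unfolding chernoff_exp_def
    by (intro Sup_upper CollectI exI[of _ "ln 2"] conjI refl exI[of _ T]) auto
qed

subsection \<open>The mixed alternative\<close>

text \<open>The trade-off with \<open>K = 2 ^ n\<close> reads: type II error below
  \<open>2 ^ -n / 8\<close> forces type I error at least \<open>K / (4 (K + K)) = 1/8\<close>, which
  is eventually excluded.\<close>

lemma type2_rate_mix_le:
  assumes T: "is_test_seq T" and lim: "(\<lambda>n. type1_error rho_dens n (T n)) \<longlonglongrightarrow> 0"
  shows "error_rate (\<lambda>n. type2_error_mix q_weight sigma_dens n (T n)) \<le> ereal (ln 2)"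
proof (rule error_rate_le[where C="1/8"])
  have "\<forall>\<^sub>F n in sequentially. type1_error rho_dens n (T n) < 1 / 8"
    by (rule order_tendstoD[OF lim]) simp
  then show "\<forall>\<^sub>F n in sequentially. 1/8 * exp (- (ln 2 * real n)) \<le> type2_error_mix q_weight sigma_dens n (T n)"
    using eventually_ge_at_top[of 1]
  proof eventually_elim
    case (elim n)
    show ?case
    proof (rule ccontr)
      assume "\<not> ?case"
      then have "type1_error rho_dens n (T n) \<ge> real (2 ^ n) / (4 * (2 ^ n + real (2 ^ n)))"
        using elim by (intro type1_error_mix_tradeoff is_test_seqD[OF T]) (auto simp: exp_neg_ln2)
      with elim show False by simp
    qed
  qed
qed simp

lemma type1_rate_mix_le:
  assumes T: "is_test_seq T"
    and r: "ereal r \<le> error_rate (\<lambda>n. type2_error_mix q_weight sigma_dens n (T n))"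
    and c: "0 < c" "c < r" "c \<le> ln 2"
  shows "error_rate (\<lambda>n. type1_error rho_dens n (T n)) \<le> ereal (ln 2 - c)"
proof (rule error_rate_le[where C="1/128"])
  have "\<forall>\<^sub>F n in sequentially. type2_error_mix q_weight sigma_dens n (T n) < exp (- (c * real n))"
    using c type2_error_mix_nonneg is_test_seqD[OF T] by (intro error_rateD[OF r]) auto
  moreover have "\<forall>\<^sub>F n in sequentially. exp (c * real n) \<ge> 8"
    using c(1) by real_asymp
  ultimately show "\<forall>\<^sub>F n in sequentially. 1/128 * exp (- ((ln 2 - c) * real n)) \<le> type1_error rho_dens n (T n)"
    using eventually_ge_at_top[of 1]
  proof eventually_elim
    case (elim n)
    define E where "E = exp (c * real n)"
    \<comment> \<open>The largest \<open>K\<close> with \<open>1 / E \<le> 1 / (8 K)\<close>, as the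
      trade-off demands of a type II error below \<open>1 / E\<close>; \<open>E \<ge> 8\<close>
      makes it at least 1.\<close>
    define K where "K = nat \<lfloor>E / 8\<rfloor>"
    have E: "E \<ge> 8" using elim by (simp add: E_def)
    then have "\<lfloor>E / 8\<rfloor> \<ge> 1" by (simp add: le_floor_iff)
    then have K_eq: "real K = of_int \<lfloor>E / 8\<rfloor>" and K1: "K \<ge> 1"
      by (simp add: K_def, unfold K_def, linarith)
    have K: "real K \<le> E / 8" "E / 8 < real K + 1" unfolding K_eq by linarith+
    have "E \<le> exp (ln 2 * real n)" using c by (simp add: E_def mult_right_mono)
    then have E2: "E \<le> 2 ^ n" by (simp add: exp_ln2)
    have "exp (- (c * real n)) = 1 / E" by (simp add: E_def exp_minus inverse_eq_divide)
    also have "\<dots> \<le> 1 / (8 * real K)" using K(1) K1 by (intro divide_left_mono) auto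
    finally have small: "exp (- (c * real n)) \<le> 1 / (8 * real K)" .
    have "real K \<ge> 1" using K1 by simp
    \<comment> \<open>Rounding down costs at most a factor 2, since \<open>K + 1 \<le> 2 K\<close>;
      the second bound rests on \<open>c \<le> ln 2\<close>.\<close>
    then have K': "E / 16 \<le> real K" "real K \<le> 2 ^ n" using K E E2 by linarith+
    from small elim have "type1_error rho_dens n (T n) \<ge> real K / (4 * (2 ^ n + real K))"
      using K1 by (intro type1_error_mix_tradeoff is_test_seqD[OF T]) auto
    \<comment> \<open>The constant is \<open>128 = 16 * 8\<close>: 16 from the bound on
      \<open>K\<close>, 8 from the denominator.\<close>
    moreover have "1 / 128 * (E / 2 ^ n) \<le> (E / 16) / (4 * (2 ^ n + 2 ^ n))"
      by (simp add: field_simps)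
    moreover have "(E / 16) / (4 * (2 ^ n + 2 ^ n)) \<le> real K / (4 * (2 ^ n + real K))"
    proof (intro frac_le)
      show "0 < 4 * (2 ^ n + real K)" by (simp add: add_pos_nonneg)
    qed (use K' E in simp_all)
    moreover have "exp (- ((ln 2 - c) * real n)) = E / 2 ^ n"
      by (simp only: E_def exp_neg_ln2_diff)
    ultimately show ?case by linarith
  qed
qed simp

lemma type1_rate_mix_le_max:
  assumes T: "is_test_seq T"
    and r: "r > 0" "ereal r \<le> error_rate (\<lambda>n. type2_error_mix q_weight sigma_dens n (T n))"
  shows "error_rate (\<lambda>n. type1_error rho_dens n (T n)) \<le> ereal (max (ln 2 - r) 0)"
proof (rule ereal_le_epsilon2)
  fix e :: real
  assume "e > 0"
  define s where "s = min r (ln 2)"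
  \<comment> \<open>The previous bound needs \<open>0 < c < r\<close> and
    \<open>c \<le> ln 2\<close>. This \<open>c\<close> is within \<open>e\<close> of
    \<open>s\<close>, where \<open>ln 2 - s\<close> is the claimed maximum; \<open>s / 2\<close>
    keeps it positive for large \<open>e\<close>.\<close>
  define c where "c = max (s - e) (s / 2)"
  have "s > 0" using r by (simp add: s_def)
  with \<open>e > 0\<close> have c: "0 < c" "c < s" "s - e \<le> c" by (auto simp: c_def)
  then have "error_rate (\<lambda>n. type1_error rho_dens n (T n)) \<le> ereal (ln 2 - c)"
    using r by (intro type1_rate_mix_le[OF T r(2)]) (auto simp: s_def)
  also have "\<dots> \<le> ereal (max (ln 2 - r) 0) + ereal e"
    using c(3) by (auto simp: s_def min_def max_def split: if_splits)
  finally show "error_rate (\<lambda>n. type1_error rho_dens n (T n)) \<le> ereal (max (ln 2 - r) 0) + ereal e" .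
qed

text \<open>The test covers about \<open>exp (a n)\<close> alternatives: the union bound gives the
  type I rate, the weight tail the type II rate. For \<open>a > ln 2\<close> the type I claim is a
  negative rate.\<close>

lemma mix_test:
  fixes a :: real
  assumes "a > 0"
  obtains T where "is_test_seq T"
    "ereal a \<le> error_rate (\<lambda>n. type2_error_mix q_weight sigma_dens n (T n))"
    "ereal (ln 2 - a) \<le> error_rate (\<lambda>n. type1_error rho_dens n (T n))"
proof
  define K where "K n = nat \<lceil>exp (a * real n)\<rceil>" for n :: nat
  let ?T = "\<lambda>n. union_test {..<K n} n"
  have test: "is_test n (?T n)" for n by (rule is_test_union_test) simp
  then show "is_test_seq ?T" by (simp add: is_test_seq_def)
  have K: "real (K n) \<ge> exp (a * real n)" "real (K n) \<le> exp (a * real n) + 1" for n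
    by (simp_all add: K_def real_nat_ceiling_ge)
  have K1: "K n \<ge> 1" for n using K(1)[of n] exp_gt_zero[of "a * real n"]
    by (cases "K n") (auto simp del: exp_gt_zero)
  show "ereal a \<le> error_rate (\<lambda>n. type2_error_mix q_weight sigma_dens n (?T n))"
  proof (rule error_rate_ge[of 2])
    have "type2_error_mix q_weight sigma_dens n (?T n) \<le> 2 * exp (- (a * real n))" for n
    proof -
      have "type2_error_mix q_weight sigma_dens n (?T n) \<le> 2 / real (K n)"
        by (rule type2_error_mix_union_test[OF K1])
      also have "\<dots> \<le> 2 / exp (a * real n)" using K(1)[of n] K1[of n] by (intro divide_left_mono) auto
      finally show ?thesis by (simp add: exp_minus field_simps)
    qed
    then show "\<forall>\<^sub>F n in sequentially. type2_error_mix q_weight sigma_dens n (?T n) \<le> 2 * exp (- (a * real n))"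
      by simp
  qed (auto intro: type2_error_mix_nonneg test)
  show "ereal (ln 2 - a) \<le> error_rate (\<lambda>n. type1_error rho_dens n (?T n))"
  proof (rule error_rate_ge[of 2])
    have "type1_error rho_dens n (?T n) \<le> 2 * exp (- ((ln 2 - a) * real n))" for n
    proof -
      have "1 \<le> exp (a * real n)" using assms by simp
      then have "real (K n) \<le> 2 * exp (a * real n)" using K(2)[of n] by linarith
      then have "real (K n) / 2 ^ n \<le> 2 * exp (a * real n) / 2 ^ n" by (rule divide_right_mono) simp
      then show ?thesis
        using type1_error_union_test[of "{..<K n}" n] by (simp add: exp_neg_ln2_diff)
    qed
    then show "\<forall>\<^sub>F n in sequentially. type1_error rho_dens n (?T n) \<le> 2 * exp (- ((ln 2 - a) * real n))"
      by simp
  qed (auto intro: type1_error_bounds test)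
qed

section \<open>The three exponents of the mixture\<close>

lemma stein_exp_mix: "stein_exp rho_dens (type2_error_mix q_weight sigma_dens) = ereal (ln 2)"
proof (rule antisym)
  show "stein_exp rho_dens (type2_error_mix q_weight sigma_dens) \<le> ereal (ln 2)"
    unfolding stein_exp_def using type2_rate_mix_le by (intro Sup_least) auto
  \<comment> \<open>Strictly below \<open>ln 2\<close> the test of \<open>mix_test\<close> has
    positive type I rate, so its type I error tends to 0; the value \<open>ln 2\<close> is then
    reached as a supremum.\<close>
  have ge: "ereal a \<le> stein_exp rho_dens (type2_error_mix q_weight sigma_dens)" if a: "0 < a" "a < ln 2" for a
  proof -
    obtain T where T: "is_test_seq T"
      "ereal a \<le> error_rate (\<lambda>n. type2_error_mix q_weight sigma_dens n (T n))"
      "ereal (ln 2 - a) \<le> error_rate (\<lambda>n. type1_error rho_dens n (T n))"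
      using mix_test[OF a(1)] .
    have nonneg: "0 \<le> type1_error rho_dens n (T n)" if "n \<ge> 1" for n
      using that by (intro type1_error_bounds is_test_seqD[OF T(1)])
    have "\<forall>\<^sub>F n in sequentially. type1_error rho_dens n (T n) < exp (- ((ln 2 - a) / 2 * real n))"
      using nonneg a by (intro error_rateD[OF T(3)]) auto
    then have upper: "\<forall>\<^sub>F n in sequentially. type1_error rho_dens n (T n) \<le> exp (- ((ln 2 - a) / 2 * real n))"
      by eventually_elim simp
    have lower: "\<forall>\<^sub>F n in sequentially. 0 \<le> type1_error rho_dens n (T n)"
      using eventually_ge_at_top[of 1] by eventually_elim (rule nonneg)
    have lim: "(\<lambda>n. exp (- ((ln 2 - a) / 2 * real n))) \<longlonglongrightarrow> 0"
      using a(2) by real_asymp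
    have "(\<lambda>n. type1_error rho_dens n (T n)) \<longlonglongrightarrow> 0"
      by (rule tendsto_sandwich[OF lower upper tendsto_const lim])
    with T(1) have "error_rate (\<lambda>n. type2_error_mix q_weight sigma_dens n (T n))
        \<le> stein_exp rho_dens (type2_error_mix q_weight sigma_dens)"
      unfolding stein_exp_def by (intro Sup_upper CollectI exI[of _ T]) auto
    with T(2) show ?thesis by (rule order_trans)
  qed
  show "ereal (ln 2) \<le> stein_exp rho_dens (type2_error_mix q_weight sigma_dens)"
  proof (rule ereal_le_epsilon2)
    fix e :: real
    assume "e > 0"
    define a where "a = max (ln 2 - e) (ln 2 / 2)"
    have a: "0 < a" "a < ln 2" "ln 2 \<le> a + e" using \<open>e > 0\<close> by (auto simp: a_def less_max_iff_disj)
    then have "ereal (ln 2) \<le> ereal a + ereal e" by simp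
    also have "\<dots> \<le> stein_exp rho_dens (type2_error_mix q_weight sigma_dens) + ereal e"
      using ge[OF a(1,2)] by (rule add_right_mono)
    finally show "ereal (ln 2) \<le> stein_exp rho_dens (type2_error_mix q_weight sigma_dens) + ereal e" .
  qed
qed

lemma direct_exp_mix:
  assumes "r > 0"
  shows "direct_exp r rho_dens (type2_error_mix q_weight sigma_dens) = ereal (max (ln 2 - r) 0)"
proof (rule antisym)
  show "direct_exp r rho_dens (type2_error_mix q_weight sigma_dens) \<le> ereal (max (ln 2 - r) 0)"
    unfolding direct_exp_def using type1_rate_mix_le_max[OF _ assms] by (intro Sup_least) auto
  obtain T where T: "is_test_seq T"
    "ereal r \<le> error_rate (\<lambda>n. type2_error_mix q_weight sigma_dens n (T n))"
    "ereal (ln 2 - r) \<le> error_rate (\<lambda>n. type1_error rho_dens n (T n))"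
    using mix_test[OF assms] .
  \<comment> \<open>For \<open>r > ln 2\<close> the guaranteed rate is negative; being at most 1,
    the type I error always has rate at least 0.\<close>
  have "\<forall>\<^sub>F n in sequentially. type1_error rho_dens n (T n) \<le> 1"
    using eventually_ge_at_top[of 1]
    by eventually_elim (intro type1_error_bounds is_test_seqD[OF T(1)])
  then have "ereal 0 \<le> error_rate (\<lambda>n. type1_error rho_dens n (T n))"
    by (intro error_rate_ge[of 1] type1_error_bounds is_test_seqD[OF T(1)]) auto
  with T(3) have "ereal (max (ln 2 - r) 0) \<le> error_rate (\<lambda>n. type1_error rho_dens n (T n))"
    by (auto simp: max_def)
  also have "\<dots> \<le> direct_exp r rho_dens (type2_error_mix q_weight sigma_dens)"
    unfolding direct_exp_def using T by (intro Sup_upper CollectI exI[of _ T]) auto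
  finally show "ereal (max (ln 2 - r) 0) \<le> direct_exp r rho_dens (type2_error_mix q_weight sigma_dens)" .
qed

lemma chernoff_exp_mix: "chernoff_exp rho_dens (type2_error_mix q_weight sigma_dens) = ereal (1 / 2 * ln 2)"
proof (rule antisym)
  show "chernoff_exp rho_dens (type2_error_mix q_weight sigma_dens) \<le> ereal (1 / 2 * ln 2)"
    unfolding chernoff_exp_def
  proof (rule Sup_least, clarify)
    fix r T
    assume *: "0 \<le> r" "is_test_seq T" "ereal r \<le> error_rate (\<lambda>n. type1_error rho_dens n (T n))"
      "ereal r \<le> error_rate (\<lambda>n. type2_error_mix q_weight sigma_dens n (T n))"
    show "ereal r \<le> ereal (1 / 2 * ln 2)"
    proof (cases "r = 0")
      case False
      with * have "error_rate (\<lambda>n. type1_error rho_dens n (T n)) \<le> ereal (max (ln 2 - r) 0)"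
        by (intro type1_rate_mix_le_max) auto
      with *(3) have "ereal r \<le> ereal (max (ln 2 - r) 0)" by (rule order_trans)
      \<comment> \<open>As \<open>r > 0\<close>, the maximum cannot be 0, so
        \<open>r \<le> ln 2 - r\<close>.\<close>
      with False *(1) show ?thesis by (auto simp: max_def split: if_splits)
    qed simp
  qed
  \<comment> \<open>This choice balances the two rates \<open>a\<close> and
    \<open>ln 2 - a\<close>.\<close>
  have "(0::real) < ln 2 / 2" by simp
  then obtain T where T: "is_test_seq T"
    "ereal (ln 2 / 2) \<le> error_rate (\<lambda>n. type2_error_mix q_weight sigma_dens n (T n))"
    "ereal (ln 2 - ln 2 / 2) \<le> error_rate (\<lambda>n. type1_error rho_dens n (T n))"
    by (rule mix_test)
  then show "ereal (1 / 2 * ln 2) \<le> chernoff_exp rho_dens (type2_error_mix q_weight sigma_dens)"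
    unfolding chernoff_exp_def
    by (intro Sup_upper CollectI exI[of _ "ln 2 / 2"] conjI exI[of _ T]) auto
qed

theorem mainTheorem3:
  fixes k :: nat
  assumes "k \<ge> 1"
  shows "(stein_exp rho_dens (type2_error_mix q_weight sigma_dens) = ereal (ln 2)
          \<and> ereal (ln 2) < \<infinity>
          \<and> stein_exp rho_dens (type2_error (sigma_dens k)) = \<infinity>)
       \<and> (\<forall>r::real. r > 0 \<longrightarrow>
            direct_exp r rho_dens (type2_error_mix q_weight sigma_dens) = ereal (max (ln 2 - r) 0)
          \<and> max (ln 2 - r) 0 < ln 2
          \<and> direct_exp r rho_dens (type2_error (sigma_dens k)) = ereal (ln 2))
       \<and> (chernoff_exp rho_dens (type2_error_mix q_weight sigma_dens) = ereal (1 / 2 * ln 2)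
          \<and> 1 / 2 * ln 2 < (ln 2 :: real)
          \<and> chernoff_exp rho_dens (type2_error (sigma_dens k)) = ereal (ln 2))"
proof -
  obtain m where k: "k = Suc m" using assms by (cases k) auto
  show ?thesis
    unfolding k
    using stein_exp_mix stein_exp_simple[of m] direct_exp_mix direct_exp_simple[of _ m]
      chernoff_exp_mix chernoff_exp_simple[of m] by auto
qed

end
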